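(* Consider estimation of the mean $\theta(P)=\mathbb E_P[X]$ over the class $\mathcal P_k^d(r)$ of distributions, in squared error. If $\mathcal Q^{\mathsf{TV}}_{\varepsilon}$ denotes the family of $\varepsilon$-total variation private channels, then $$\inf_{Q\in\mathcal Q^{\mathsf{TV}}_{\varepsilon}}\ \sup_{P\in\mathcal P_k^d(r)}\ \mathbb E_{P,Q}\left[\big\|\widehat\theta(X_{1:n})-\mathbb E_P[X]\big\|_2^2\right]\ \gtrsim\ \frac{r^2}{n}+r^2\left(\frac{1}{\varepsilon^2n^2}\right)^{\frac{k-1}{k}}.$$
   Context: $\mathcal P_k^d(r)$ is the set of probability distributions $P$ supported on $\mathbb R^d$ with $\mathbb E_P[\|X\|_2^k]\le r^k$, where $k>1$ and $r>0$ are fixed. A channel $Q$ is a Markov kernel from $(\mathbb R^d)^n$ to $\mathbb R^d$. Given $P$ and $Q$, $X_1,\dots,X_n$ are drawn i.i.d. from $P$ and then, conditionally on $X_{1:n}=(X_1,\dots,X_n)$, the estimator $\widehat\theta(X_{1:n})$ is drawn from $Q(\cdot\mid X_{1:n})$; $\mathbb E_{P,Q}$ is expectation over both. A channel $Q$ is $\varepsilon$-total variation private if $|Q(A\mid x_{1:n})-Q(A\mid x'_{1:n})|\le\varepsilon$ for all measurable $A$ and all $x_{1:n},x'_{1:n}$ differing in only one observation. The notation $a_n\gtrsim b_n$ means that $a_n\ge c\,b_n$ for some constant $c>0$ and for all $n\ge1$. *)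

theory Defs
  imports "HOL-Probability.Probability"
begin

text \<open>
  The space of \<open>d\<close>-dimensional real vectors has an explicit index set rather than a type-level
  dimension, so that the constant in the lower bound can be chosen before \<open>d\<close>. Its points are the
  functions that are \<open>undefined\<close> outside \<open>{..<d}\<close>, and \<open>L2_set x {..<d}\<close> is the Euclidean norm.
\<close>

definition eucl :: "nat \<Rightarrow> (nat \<Rightarrow> real) measure" where
  "eucl d = (\<Pi>\<^sub>M i\<in>{..<d}. borel)"

definition mean :: "nat \<Rightarrow> (nat \<Rightarrow> real) measure \<Rightarrow> nat \<Rightarrow> real" where
  "mean d P = (\<lambda>i\<in>{..<d}. \<integral>x. x i \<partial>P)"

definition moment_class :: "nat \<Rightarrow> real \<Rightarrow> real \<Rightarrow> (nat \<Rightarrow> real) measure set" where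
  "moment_class d k r =
    {P \<in> space (prob_algebra (eucl d)).
      (\<integral>\<^sup>+x. ennreal (L2_set x {..<d} powr k) \<partial>P) \<le> ennreal (r powr k)}"

definition samples :: "nat \<Rightarrow> nat \<Rightarrow> (nat \<Rightarrow> nat \<Rightarrow> real) measure" where
  "samples d n = (\<Pi>\<^sub>M j\<in>{..<n}. eucl d)"

definition channels :: "nat \<Rightarrow> nat \<Rightarrow> ((nat \<Rightarrow> nat \<Rightarrow> real) \<Rightarrow> (nat \<Rightarrow> real) measure) set" where
  "channels d n = samples d n \<rightarrow>\<^sub>M prob_algebra (eucl d)"

definition adjacent :: "nat \<Rightarrow> (nat \<Rightarrow> nat \<Rightarrow> real) \<Rightarrow> (nat \<Rightarrow> nat \<Rightarrow> real) \<Rightarrow> bool" where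
  "adjacent n xs xs' \<longleftrightarrow> (\<exists>i<n. \<forall>j<n. j \<noteq> i \<longrightarrow> xs j = xs' j)"

definition tv_private_channels ::
    "nat \<Rightarrow> nat \<Rightarrow> real \<Rightarrow> ((nat \<Rightarrow> nat \<Rightarrow> real) \<Rightarrow> (nat \<Rightarrow> real) measure) set" where
  "tv_private_channels d n \<epsilon> =
    {Q \<in> channels d n.
      \<forall>A\<in>sets (eucl d). \<forall>xs\<in>space (samples d n). \<forall>xs'\<in>space (samples d n).
        adjacent n xs xs' \<longrightarrow> \<bar>measure (Q xs) A - measure (Q xs') A\<bar> \<le> \<epsilon>}"

definition risk ::
    "nat \<Rightarrow> nat \<Rightarrow> ((nat \<Rightarrow> nat \<Rightarrow> real) \<Rightarrow> (nat \<Rightarrow> real) measure) \<Rightarrow> (nat \<Rightarrow> real) measure \<Rightarrow> ennreal" where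
  "risk d n Q P =
    (\<integral>\<^sup>+xs. (\<integral>\<^sup>+t. ennreal ((L2_set (\<lambda>i. t i - mean d P i) {..<d})\<^sup>2) \<partial>Q xs)
      \<partial>(\<Pi>\<^sub>M j\<in>{..<n}. P))"

definition minimax_risk :: "nat \<Rightarrow> real \<Rightarrow> real \<Rightarrow> real \<Rightarrow> nat \<Rightarrow> ennreal" where
  "minimax_risk d k r \<epsilon> n = (INF Q\<in>tv_private_channels d n \<epsilon>. SUP P\<in>moment_class d k r. risk d n Q P)"

text \<open>
  On the constant in \<open>minimax_risk d k r \<epsilon> n \<ge> c * (\<dots>)\<close>: the risk never exceeds \<open>r\<^sup>2\<close> (always answer
  0), while \<open>(1 / (\<epsilon>\<^sup>2 * n\<^sup>2)) powr ((k - 1) / k)\<close> is unbounded as \<open>n * \<epsilon>\<close> tends to 0, so no \<open>c\<close>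
  serves all positive \<open>\<epsilon>\<close>. The constant is therefore chosen after a number \<open>\<epsilon>\<^sub>0 > 0\<close>, arbitrarily
  small, and serves all \<open>n \<ge> 1\<close> and \<open>\<epsilon> \<ge> \<epsilon>\<^sub>0 / n\<close>. For a fixed privacy level take \<open>\<epsilon>\<^sub>0 = \<epsilon>\<close>: then
  every \<open>n \<ge> 1\<close> is covered.
\<close>

end

theory Submission
  imports Defs
begin

text \<open>
  Both terms come from Le Cam's two-point method along the first coordinate axis. For \<open>r\<^sup>2 / n\<close>, the
  uniform distribution on \<open>\<plusminus>r\<close> is compared with its tilt by \<open>1 + \<delta> sgn\<close>, where \<open>\<delta>\<^sup>2 = 1 / (8 n)\<close>; the
  \<open>n\<close>-fold products have chi-square divergence \<open>(1 + \<delta>\<^sup>2)\<^sup>n - 1 \<le> 1 / 4\<close>. For the privacy term, the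
  point mass at 0 is compared with the distribution that moves mass \<open>p = min 1 (1 / (2 \<epsilon> n))\<close> to
  \<open>r p powr (- 1 / k)\<close>, the farthest point that the moment constraint allows. On average \<open>n p\<close> observations
  differ from 0, so privacy bounds the total variation distance of the outputs by \<open>\<epsilon> n p \<le> 1 / 2\<close>, while
  the means are \<open>r p powr (1 - 1 / k)\<close> apart.
\<close>

section \<open>Densities of product measures and a chi-square bound\<close>

text \<open>Both sides agree on boxes: the product of the \<open>g (x i)\<close> times the indicator
  of a box is a product of functions of one coordinate each, so its integral factorizes by
  Fubini.\<close>

lemma PiM_density:
  assumes "finite I" "prob_space P" and [measurable]: "g \<in> borel_measurable P"
    and "prob_space (density P g)"
  shows "PiM I (\<lambda>_. density P g) = density (PiM I (\<lambda>_. P)) (\<lambda>x. \<Prod>i\<in>I. g (x i))"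
proof -
  interpret P: prob_space P by fact
  interpret D: prob_space "density P g" by fact
  interpret P: product_sigma_finite "\<lambda>_. P" by standard
  interpret D: product_sigma_finite "\<lambda>_. density P g" by standard
  show ?thesis
  proof (rule D.PiM_eqI[symmetric])
    show "sets (density (PiM I (\<lambda>_. P)) (\<lambda>x. \<Prod>i\<in>I. g (x i))) = sets (PiM I (\<lambda>_. density P g))"
      by (simp cong: sets_PiM_cong)
    fix A assume "\<And>i. i \<in> I \<Longrightarrow> A i \<in> sets (density P g)"
    then have A: "\<And>i. i \<in> I \<Longrightarrow> A i \<in> sets P" by simp
    have "emeasure (density (PiM I (\<lambda>_. P)) (\<lambda>x. \<Prod>i\<in>I. g (x i))) (Pi\<^sub>E I A)
        = (\<integral>\<^sup>+x. (\<Prod>i\<in>I. g (x i)) * indicator (Pi\<^sub>E I A) x \<partial>PiM I (\<lambda>_. P))"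
      using A \<open>finite I\<close> by (subst emeasure_density) (auto intro!: sets_PiM_I_finite)
    also have "\<dots> = (\<integral>\<^sup>+x. (\<Prod>i\<in>I. g (x i) * indicator (A i) (x i)) \<partial>PiM I (\<lambda>_. P))"
    proof (rule nn_integral_cong)
      fix x assume "x \<in> space (PiM I (\<lambda>_. P))"
      then have "indicator (Pi\<^sub>E I A) x = (\<Prod>i\<in>I. indicator (A i) (x i) :: ennreal)"
        using \<open>finite I\<close>
        by (auto simp: indicator_def space_PiM PiE_iff intro!: prod_zero[symmetric])
      then show "(\<Prod>i\<in>I. g (x i)) * indicator (Pi\<^sub>E I A) x = (\<Prod>i\<in>I. g (x i) * indicator (A i) (x i))"
        by (simp add: prod.distrib)
    qed
    also have "\<dots> = (\<Prod>i\<in>I. \<integral>\<^sup>+x. g x * indicator (A i) x \<partial>P)"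
      using A \<open>finite I\<close> by (intro P.product_nn_integral_prod) auto
    also have "\<dots> = (\<Prod>i\<in>I. emeasure (density P g) (A i))"
      using A by (intro prod.cong) (auto simp: emeasure_density)
    finally show "emeasure (density (PiM I (\<lambda>_. P)) (\<lambda>x. \<Prod>i\<in>I. g (x i))) (Pi\<^sub>E I A)
      = (\<Prod>i\<in>I. emeasure (density P g) (A i))" .
  qed (use \<open>finite I\<close> in auto)
qed

text \<open>The likelihood ratio \<open>h\<close> of the two products has mean 1 and second moment
  \<open>(\<integral>x. (g x)\<^sup>2 \<partial>P) ^ card I\<close>, so the right-hand side is their
  chi-square divergence plus 1/4. In this form, a single pointwise inequality takes the place of
  Cauchy-Schwarz.\<close>

lemma integral_PiM_density_diff_le:
  fixes g :: "'a \<Rightarrow> real"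
  assumes I: "finite I" and P: "prob_space P" and [measurable]: "g \<in> borel_measurable P"
    and g0: "\<And>x. 0 \<le> g x" and D: "prob_space (density P (\<lambda>x. ennreal (g x)))"
    and int_g: "integrable P g" and int_g2: "integrable P (\<lambda>x. (g x)\<^sup>2)"
    and [measurable]: "f \<in> borel_measurable (PiM I (\<lambda>_. P))"
    and f01: "\<And>x. x \<in> space (PiM I (\<lambda>_. P)) \<Longrightarrow> 0 \<le> f x \<and> f x \<le> 1"
  shows "(\<integral>x. f x \<partial>PiM I (\<lambda>_. density P (\<lambda>x. ennreal (g x)))) - (\<integral>x. f x \<partial>PiM I (\<lambda>_. P))
    \<le> (\<integral>x. (g x)\<^sup>2 \<partial>P) ^ card I - 3 / 4"
proof -
  interpret P: prob_space P by fact
  interpret P: product_sigma_finite "\<lambda>_. P" by standard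
  let ?M = "PiM I (\<lambda>_. P)"
  interpret M: prob_space ?M by (intro prob_space_PiM P)
  define h where "h x = (\<Prod>i\<in>I. g (x i))" for x
  have [measurable]: "h \<in> borel_measurable ?M"
    unfolding h_def by measurable
  have h0: "0 \<le> h x" for x
    unfolding h_def by (intro prod_nonneg) (auto simp: g0)
  have h2_eq: "(h x)\<^sup>2 = (\<Prod>i\<in>I. (g (x i))\<^sup>2)" for x
    by (simp add: h_def prod_power_distrib)
  have "(\<integral>\<^sup>+x. ennreal (g x) \<partial>P) = 1"
    using prob_space.emeasure_space_1[OF D] by (simp add: emeasure_density cong: nn_integral_cong)
  then have g1: "(\<integral>x. g x \<partial>P) = 1"
    using g0 by (simp add: integral_eq_nn_integral)
  have int_h: "integrable ?M h" and Eh: "(\<integral>x. h x \<partial>?M) = 1"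
    using P.product_integrable_prod[OF I, of "\<lambda>_. g"] P.product_integral_prod[OF I, of "\<lambda>_. g"] int_g g1
    by (simp_all add: h_def[abs_def])
  have int_h2: "integrable ?M (\<lambda>x. (h x)\<^sup>2)"
    and Eh2: "(\<integral>x. (h x)\<^sup>2 \<partial>?M) = (\<integral>x. (g x)\<^sup>2 \<partial>P) ^ card I"
    using P.product_integrable_prod[OF I, of "\<lambda>_ x. (g x)\<^sup>2"]
      P.product_integral_prod[OF I, of "\<lambda>_ x. (g x)\<^sup>2"] int_g2
    by (simp_all add: h2_eq)
  have int_f: "integrable ?M f"
    using f01 by (intro M.integrable_const_bound[of _ 1]) auto
  have int_hf: "integrable ?M (\<lambda>x. h x * f x)"
  proof (rule Bochner_Integration.integrable_bound[OF int_h])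
    show "AE x in ?M. norm (h x * f x) \<le> norm (h x)"
      using f01 h0 by (intro AE_I2) (simp add: mult_left_le abs_mult)
  qed measurable
  have "(\<integral>x. f x \<partial>PiM I (\<lambda>_. density P (\<lambda>x. ennreal (g x))))
      = (\<integral>x. f x \<partial>density ?M (\<lambda>x. ennreal (h x)))"
    by (subst PiM_density[OF I P _ D]) (simp_all add: h_def prod_ennreal g0)
  also have "\<dots> = (\<integral>x. h x * f x \<partial>?M)"
    by (subst integral_density) (auto simp: h0)
  finally have "(\<integral>x. f x \<partial>PiM I (\<lambda>_. density P (\<lambda>x. ennreal (g x)))) - (\<integral>x. f x \<partial>?M)
      = (\<integral>x. h x * f x - f x \<partial>?M)"
    using int_hf int_f by simp
  also have "\<dots> \<le> (\<integral>x. (h x)\<^sup>2 - 2 * h x + 5 / 4 \<partial>?M)"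
  proof (rule integral_mono)
    fix x assume "x \<in> space ?M"
    then have "(f x)\<^sup>2 \<le> 1" using f01 by (simp add: power_le_one)
    \<comment> \<open>Expanding the square gives (h - 1) f \<le> (h - 1)^2 + f^2 / 4; with f^2 \<le>
      1 the constants add up to 1 + 1/4 = 5/4.\<close>
    moreover have "0 \<le> (h x - 1 - f x / 2)\<^sup>2" by simp
    ultimately show "h x * f x - f x \<le> (h x)\<^sup>2 - 2 * h x + 5 / 4"
      by (simp add: power2_eq_square algebra_simps)
  qed (use int_hf int_f int_h int_h2 in auto)
  also have "\<dots> = (\<integral>x. (g x)\<^sup>2 \<partial>P) ^ card I - 3 / 4"
    using int_h int_h2 by (simp add: Eh Eh2 M.prob_space)
  finally show ?thesis .
qed

section \<open>Distributions with at most two atoms on the first axis\<close>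

definition axis_point :: "nat \<Rightarrow> real \<Rightarrow> nat \<Rightarrow> real" where
  "axis_point d s = (\<lambda>i\<in>{..<d}. if i = 0 then s else 0)"

text \<open>As a pushforward of a Bernoulli law, it makes measurability of the map trivial and every
  integral a two-term sum. All hypotheses tested below have this form: atoms at \<open>r\<close> and
  \<open>- r\<close> for the sampling term, atoms at a far point and at 0 for the privacy
  term.\<close>

definition two_point :: "nat \<Rightarrow> real \<Rightarrow> real \<Rightarrow> real \<Rightarrow> (nat \<Rightarrow> real) measure" where
  "two_point d p s t =
    distr (measure_pmf (bernoulli_pmf p)) (eucl d) (\<lambda>b. axis_point d (if b then s else t))"

lemma axis_point_in_space [simp]: "axis_point d s \<in> space (eucl d)"
  by (auto simp: axis_point_def eucl_def space_PiM)

lemma axis_point_0: "0 < d \<Longrightarrow> axis_point d s 0 = s"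
  by (simp add: axis_point_def)

lemma L2_set_axis_point: "0 < d \<Longrightarrow> L2_set (axis_point d s) {..<d} = \<bar>s\<bar>"
  by (simp add: L2_set_def axis_point_def if_distrib[of "\<lambda>x. x\<^sup>2"] sum.delta cong: if_cong)

lemma measurable_two_point_map [measurable]:
  "(\<lambda>b. axis_point d (if b then s else t)) \<in> measure_pmf (bernoulli_pmf p) \<rightarrow>\<^sub>M eucl d"
  by (simp add: measurable_def)

lemma measurable_coord [measurable]: "i < d \<Longrightarrow> (\<lambda>x. x i) \<in> borel_measurable (eucl d)"
  by (simp add: eucl_def)

lemma sets_two_point [measurable_cong, simp]: "sets (two_point d p s t) = sets (eucl d)"
  by (simp add: two_point_def)

lemma space_two_point [simp]: "space (two_point d p s t) = space (eucl d)"
  by (simp add: two_point_def)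

lemma prob_space_two_point: "prob_space (two_point d p s t)"
  unfolding two_point_def by (intro prob_space.prob_space_distr prob_space_measure_pmf) measurable

lemma nn_integral_two_point:
  assumes "0 \<le> p" "p \<le> 1" and "f \<in> borel_measurable (eucl d)"
  shows "(\<integral>\<^sup>+x. f x \<partial>two_point d p s t)
    = f (axis_point d s) * ennreal p + f (axis_point d t) * ennreal (1 - p)"
  using assms by (simp add: two_point_def nn_integral_distr)

lemma integrable_two_point:
  fixes f :: "_ \<Rightarrow> real"
  assumes "f \<in> borel_measurable (eucl d)"
  shows "integrable (two_point d p s t) f"
  using assms
  by (simp add: two_point_def integrable_distr_eq integrable_measure_pmf_finite)

lemma integral_two_point:
  fixes f :: "_ \<Rightarrow> real"
  assumes "0 \<le> p" "p \<le> 1" and "f \<in> borel_measurable (eucl d)"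
  shows "(\<integral>x. f x \<partial>two_point d p s t) = f (axis_point d s) * p + f (axis_point d t) * (1 - p)"
  using assms by (simp add: two_point_def integral_distr)

lemma mean_two_point:
  assumes "0 \<le> p" "p \<le> 1" "0 < d"
  shows "mean d (two_point d p s t) 0 = s * p + t * (1 - p)"
  using assms by (simp add: mean_def integral_two_point axis_point_0)

lemma two_point_in_moment_class:
  assumes "0 \<le> p" "p \<le> 1" "0 < d" "\<bar>s\<bar> powr k * p + \<bar>t\<bar> powr k * (1 - p) \<le> r powr k"
  shows "two_point d p s t \<in> moment_class d k r"
proof -
  have [measurable]: "(\<lambda>x. L2_set x {..<d}) \<in> borel_measurable (eucl d)"
    unfolding L2_set_def by measurable
  have "(\<integral>\<^sup>+x. ennreal (L2_set x {..<d} powr k) \<partial>two_point d p s t)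
      = ennreal (\<bar>s\<bar> powr k * p + \<bar>t\<bar> powr k * (1 - p))"
    using assms by (simp add: nn_integral_two_point L2_set_axis_point ennreal_mult ennreal_plus)
  then show ?thesis
    using assms
    by (simp add: moment_class_def space_prob_algebra prob_space_two_point ennreal_leI del: ennreal_plus)
qed

text \<open>The factor is \<open>1 + \<delta>\<close> at the atom \<open>r\<close> and
  \<open>1 - \<delta>\<close> at the atom \<open>- r\<close>, so it turns the weights 1/2 into the
  new ones. The density form feeds the chi-square bound; the form with two atoms gives the mean and
  the moments.\<close>

lemma two_point_eq_density:
  assumes "\<bar>\<delta>\<bar> \<le> 1" "0 < d" "0 < r"
  shows "two_point d ((1 + \<delta>) / 2) r (- r)
    = density (two_point d (1 / 2) r (- r)) (\<lambda>x. ennreal (1 + \<delta> * sgn (x 0)))"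
proof (rule measure_eqI)
  fix A assume "A \<in> sets (two_point d ((1 + \<delta>) / 2) r (- r))"
  then have A [measurable]: "A \<in> sets (eucl d)" by simp
  note [measurable] = measurable_coord[OF \<open>0 < d\<close>]
  have e: "ennreal (1 + \<delta>) * ennreal (1 / 2) = ennreal ((1 + \<delta>) / 2)"
      "ennreal (1 - \<delta>) * ennreal (1 / 2) = ennreal (1 - (1 + \<delta>) / 2)"
    using assms by (simp_all add: ennreal_mult[symmetric] field_simps del: ennreal_half)
  have "emeasure (two_point d ((1 + \<delta>) / 2) r (- r)) A
      = (\<integral>\<^sup>+x. indicator A x \<partial>two_point d ((1 + \<delta>) / 2) r (- r))"
    by simp
  also have "\<dots> = indicator A (axis_point d r) * ennreal ((1 + \<delta>) / 2)
      + indicator A (axis_point d (- r)) * ennreal (1 - (1 + \<delta>) / 2)"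
    using assms by (intro nn_integral_two_point) auto
  also have "\<dots> = (\<integral>\<^sup>+x. ennreal (1 + \<delta> * sgn (x 0)) * indicator A x \<partial>two_point d (1 / 2) r (- r))"
    using assms
    by (subst nn_integral_two_point) (auto simp: axis_point_0 e[symmetric] mult_ac)
  also have "\<dots> = emeasure (density (two_point d (1 / 2) r (- r)) (\<lambda>x. ennreal (1 + \<delta> * sgn (x 0)))) A"
    by (subst emeasure_density) auto
  finally show "emeasure (two_point d ((1 + \<delta>) / 2) r (- r)) A = \<dots>" .
qed simp

section \<open>Channels, error probabilities and Le Cam's method\<close>

text \<open>\<open>M\<close> stands for the law of the sample, whose sigma-algebra is only equal to
  that of \<open>samples d n\<close>; this covers the products of all the distributions
  compared.\<close>

lemma measurable_channel:
  assumes "Q \<in> channels d n" "A \<in> sets (eucl d)" "sets M = sets (samples d n)"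
  shows "(\<lambda>xs. measure (Q xs) A) \<in> borel_measurable M"
proof -
  have "Q \<in> M \<rightarrow>\<^sub>M prob_algebra (eucl d)"
    using assms measurable_cong_sets[of M "samples d n"] by (auto simp: channels_def)
  then show ?thesis
    using measurable_compose measurable_measure_prob_algebra[OF assms(2)] by blast
qed

lemma channel_prob_space:
  assumes "Q \<in> channels d n" "xs \<in> space (samples d n)"
  shows "prob_space (Q xs)" "sets (Q xs) = sets (eucl d)"
  using measurable_space[OF assms(1)[unfolded channels_def] assms(2)]
  by (auto simp: space_prob_algebra)

lemma sets_PiM_samples: "sets P = sets (eucl d) \<Longrightarrow> sets (\<Pi>\<^sub>M j\<in>{..<n}. P) = sets (samples d n)"
  unfolding samples_def by (intro sets_PiM_cong) auto

text \<open>Markov's inequality: on \<open>A\<close> the loss is at least \<open>s\<^sup>2\<close>,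
  because the first coordinate alone is off by \<open>s\<close>. Using one coordinate keeps the
  bound free of \<open>d\<close>.\<close>

lemma risk_ge_error_prob:
  assumes Q: "Q \<in> channels d n" and P: "sets P = sets (eucl d)" "prob_space P"
    and A: "A \<in> sets (eucl d)" and "0 < d" "0 \<le> s"
    and far: "\<And>t. t \<in> A \<Longrightarrow> s \<le> \<bar>t 0 - mean d P 0\<bar>"
  shows "ennreal (s\<^sup>2 * (\<integral>xs. measure (Q xs) A \<partial>(\<Pi>\<^sub>M j\<in>{..<n}. P))) \<le> risk d n Q P"
proof -
  let ?M = "\<Pi>\<^sub>M j\<in>{..<n}. P"
  interpret M: prob_space ?M by (intro prob_space_PiM P)
  have sp: "space ?M = space (samples d n)"
    using sets_PiM_samples[OF P(1)] by (rule sets_eq_imp_space_eq)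
  have meas: "(\<lambda>xs. measure (Q xs) A) \<in> borel_measurable ?M"
    by (rule measurable_channel[OF Q A sets_PiM_samples[OF P(1)]])
  have le1: "measure (Q xs) A \<le> 1" if "xs \<in> space ?M" for xs
    using channel_prob_space[OF Q] that sp by (simp add: prob_space.prob_le_1)
  have "ennreal (s\<^sup>2 * (\<integral>xs. measure (Q xs) A \<partial>?M)) = ennreal (\<integral>xs. s\<^sup>2 * measure (Q xs) A \<partial>?M)"
    by simp
  also have "\<dots> = (\<integral>\<^sup>+xs. ennreal (s\<^sup>2 * measure (Q xs) A) \<partial>?M)"
    using meas le1
    by (intro nn_integral_eq_integral[symmetric] integrable_mult_right M.integrable_const_bound[of _ 1]) auto
  also have "\<dots> \<le> risk d n Q P"
    unfolding risk_def
  proof (rule nn_integral_mono)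
    fix xs assume xs: "xs \<in> space ?M"
    interpret Qx: prob_space "Q xs" using channel_prob_space[OF Q] xs sp by simp
    have sets_Q: "A \<in> sets (Q xs)" using channel_prob_space[OF Q] xs sp A by simp
    have "ennreal (s\<^sup>2 * measure (Q xs) A) = (\<integral>\<^sup>+t. ennreal (s\<^sup>2) * indicator A t \<partial>Q xs)"
      using sets_Q by (simp add: nn_integral_cmult_indicator Qx.emeasure_eq_measure ennreal_mult)
    also have "\<dots> \<le> (\<integral>\<^sup>+t. ennreal ((L2_set (\<lambda>i. t i - mean d P i) {..<d})\<^sup>2) \<partial>Q xs)"
    proof (rule nn_integral_mono)
      fix t
      have "s\<^sup>2 \<le> (L2_set (\<lambda>i. t i - mean d P i) {..<d})\<^sup>2" if "t \<in> A"
      proof (rule power_mono[OF _ \<open>0 \<le> s\<close>])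
        have "L2_set (\<lambda>i. t i - mean d P i) {0} \<le> L2_set (\<lambda>i. t i - mean d P i) {..<d}"
          unfolding L2_set_def using \<open>0 < d\<close>
          by (intro real_sqrt_le_mono sum_mono2) auto
        then show "s \<le> L2_set (\<lambda>i. t i - mean d P i) {..<d}"
          using far[OF that] by (simp add: L2_set_def)
      qed
      then show "ennreal (s\<^sup>2) * indicator A t \<le> ennreal ((L2_set (\<lambda>i. t i - mean d P i) {..<d})\<^sup>2)"
        by (auto simp: indicator_def intro!: ennreal_leI)
    qed
    finally show "ennreal (s\<^sup>2 * measure (Q xs) A)
      \<le> (\<integral>\<^sup>+t. ennreal ((L2_set (\<lambda>i. t i - mean d P i) {..<d})\<^sup>2) \<partial>Q xs)" .
  qed
  finally show ?thesis .
qed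

lemma moment_classD:
  "P \<in> moment_class d k r \<Longrightarrow> sets P = sets (eucl d)"
  "P \<in> moment_class d k r \<Longrightarrow> prob_space P"
  by (auto simp: moment_class_def space_prob_algebra)

text \<open>An estimator yields a test of \<open>P\<close> against \<open>P'\<close> by comparing
  its first coordinate with the midpoint \<open>s\<close> of the means. Any wrong decision costs at
  least \<open>s\<^sup>2\<close>, and the two error probabilities add up to at least 1/2.\<close>

lemma le_cam_two_point:
  fixes s :: real
  assumes Q: "Q \<in> channels d n" and "0 < d" "0 \<le> s"
    and P: "P \<in> moment_class d k r" "P' \<in> moment_class d k r"
    and means: "mean d P 0 = 0" "mean d P' 0 = 2 * s"
    and tv: "\<And>A. A \<in> sets (eucl d) \<Longrightarrow> (\<integral>xs. measure (Q xs) A \<partial>(\<Pi>\<^sub>M j\<in>{..<n}. P'))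
      - (\<integral>xs. measure (Q xs) A \<partial>(\<Pi>\<^sub>M j\<in>{..<n}. P)) \<le> 1 / 2"
  shows "ennreal (s\<^sup>2 / 4) \<le> (SUP P\<in>moment_class d k r. risk d n Q P)"
proof -
  note [measurable] = measurable_coord[OF \<open>0 < d\<close>]
  \<comment> \<open>The event that the midpoint test decides for \<open>P'\<close>: an error under
    \<open>P\<close>, while its complement is an error under \<open>P'\<close>.\<close>
  define A where "A = {t \<in> space (eucl d). s \<le> t 0}"
  have A: "A \<in> sets (eucl d)" unfolding A_def by measurable
  then have A': "space (eucl d) - A \<in> sets (eucl d)" by auto
  let ?M = "\<Pi>\<^sub>M j\<in>{..<n}. P" and ?M' = "\<Pi>\<^sub>M j\<in>{..<n}. P'"
  interpret M': prob_space ?M' by (intro prob_space_PiM moment_classD[OF P(2)])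
  have sp: "space ?M' = space (samples d n)"
    using sets_PiM_samples[OF moment_classD(1)[OF P(2)]] by (rule sets_eq_imp_space_eq)
  have compl: "measure (Q xs) (space (eucl d) - A) = 1 - measure (Q xs) A" if "xs \<in> space ?M'" for xs
  proof -
    have "space (Q xs) = space (eucl d)"
      using channel_prob_space(2)[OF Q] that sp by (metis sets_eq_imp_space_eq)
    then show ?thesis
      using channel_prob_space[OF Q] that sp A by (metis prob_space.prob_compl)
  qed
  have int: "integrable ?M' (\<lambda>xs. measure (Q xs) A)"
    using channel_prob_space[OF Q] sp
    by (intro M'.integrable_const_bound[of _ 1] measurable_channel[OF Q A]
        sets_PiM_samples moment_classD[OF P(2)])
      (auto simp: prob_space.prob_le_1)
  have E': "(\<integral>xs. measure (Q xs) (space (eucl d) - A) \<partial>?M') = 1 - (\<integral>xs. measure (Q xs) A \<partial>?M')"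
    using int by (simp add: compl M'.prob_space cong: Bochner_Integration.integral_cong)
  have r0: "ennreal (s\<^sup>2 * (\<integral>xs. measure (Q xs) A \<partial>?M)) \<le> risk d n Q P"
    using \<open>0 \<le> s\<close> \<open>0 < d\<close> means
    by (intro risk_ge_error_prob[OF Q moment_classD[OF P(1)] A]) (auto simp: A_def)
  have r1: "ennreal (s\<^sup>2 * (1 - (\<integral>xs. measure (Q xs) A \<partial>?M'))) \<le> risk d n Q P'"
    unfolding E'[symmetric]
    using \<open>0 \<le> s\<close> \<open>0 < d\<close> means
    by (intro risk_ge_error_prob[OF Q moment_classD[OF P(2)] A']) (auto simp: A_def)
  \<comment> \<open>By \<open>tv\<close> the two error probabilities have sum at least 1/2, so one
    of them is at least 1/4.\<close>
  consider "1 / 4 \<le> (\<integral>xs. measure (Q xs) A \<partial>?M)" | "1 / 4 \<le> 1 - (\<integral>xs. measure (Q xs) A \<partial>?M')"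
    using tv[OF A] by linarith
  then show ?thesis
  proof cases
    case 1
    then have "s\<^sup>2 / 4 \<le> s\<^sup>2 * (\<integral>xs. measure (Q xs) A \<partial>?M)"
      using mult_left_mono[OF 1, of "s\<^sup>2"] by simp
    then show ?thesis
      using r0 P(1) by (meson SUP_upper2 ennreal_leI order_trans)
  next
    case 2
    then have "s\<^sup>2 / 4 \<le> s\<^sup>2 * (1 - (\<integral>xs. measure (Q xs) A \<partial>?M'))"
      using mult_left_mono[OF 2, of "s\<^sup>2"] by simp
    then show ?thesis
      using r1 P(2) by (meson SUP_upper2 ennreal_leI order_trans)
  qed
qed

section \<open>The sampling term\<close>

text \<open>This error is present without any privacy requirement, so \<open>Q\<close> ranges over
  all channels. The tilted law has mean \<open>\<delta> * r\<close> on the first axis, and both laws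
  live on points of norm \<open>r\<close>.\<close>

lemma sup_risk_ge_sampling:
  assumes Q: "Q \<in> channels d n" and "0 < d" "0 < r" "1 \<le> n"
  shows "ennreal (r\<^sup>2 / (128 * real n)) \<le> (SUP P\<in>moment_class d k r. risk d n Q P)"
proof -
  \<comment> \<open>The tilt is small enough for (1 + \<delta>^2)^n \<le> exp (1/8) \<le> 5/4, and
    5/4 - 3/4 is the bound 1/2 that Le Cam's method asks for.\<close>
  define \<delta> where "\<delta> = sqrt (1 / (8 * real n))"
  have \<delta>2: "\<delta>\<^sup>2 = 1 / (8 * real n)" by (simp add: \<delta>_def)
  have "\<delta> \<le> 1"
    unfolding \<delta>_def using \<open>1 \<le> n\<close> by (simp add: field_simps)
  then have \<delta>: "0 \<le> \<delta>" "\<delta> \<le> 1" by (auto simp: \<delta>_def)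
  note [measurable] = measurable_coord[OF \<open>0 < d\<close>]
  let ?P = "two_point d (1 / 2) r (- r)" and ?g = "\<lambda>x::nat \<Rightarrow> real. 1 + \<delta> * sgn (x 0)"
  let ?P' = "density ?P (\<lambda>x. ennreal (?g x))"
  have P'_eq: "?P' = two_point d ((1 + \<delta>) / 2) r (- r)"
    using two_point_eq_density[of \<delta> d r] \<delta> assms by simp
  have "(1 + \<delta>\<^sup>2) ^ n \<le> exp (\<delta>\<^sup>2) ^ n"
    by (intro power_mono exp_ge_add_one_self) auto
  also have "\<dots> = exp (1 / 8)"
    using \<open>1 \<le> n\<close> by (simp add: exp_of_nat_mult[symmetric] \<delta>2)
  also have "\<dots> \<le> 5 / 4"
    using exp_bound[of "1 / 8"] by (simp add: power2_eq_square)
  finally have pow: "(1 + \<delta>\<^sup>2) ^ n \<le> 5 / 4" .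
  \<comment> \<open>Under the symmetric law the sign has mean 0 and its square is 1, so only the
    constant and \<delta>^2 remain.\<close>
  have g2: "(\<integral>x. (?g x)\<^sup>2 \<partial>?P) = 1 + \<delta>\<^sup>2"
    using \<open>0 < r\<close> \<open>0 < d\<close>
    by (subst integral_two_point) (auto simp: axis_point_0 power2_eq_square field_simps)
  have "ennreal ((\<delta> * r / 2)\<^sup>2 / 4) \<le> (SUP P\<in>moment_class d k r. risk d n Q P)"
  proof (rule le_cam_two_point[OF Q \<open>0 < d\<close>, of _ ?P _ _ ?P'])
    show "?P \<in> moment_class d k r" "?P' \<in> moment_class d k r"
      unfolding P'_eq using \<delta> assms
      by (auto intro!: two_point_in_moment_class simp: field_simps)
    show "mean d ?P 0 = 0" "mean d ?P' 0 = 2 * (\<delta> * r / 2)"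
      unfolding P'_eq using \<delta> assms by (auto simp: mean_two_point field_simps)
    fix A assume A: "A \<in> sets (eucl d)"
    have "(\<integral>xs. measure (Q xs) A \<partial>(\<Pi>\<^sub>M j\<in>{..<n}. ?P')) - (\<integral>xs. measure (Q xs) A \<partial>(\<Pi>\<^sub>M j\<in>{..<n}. ?P))
        \<le> (\<integral>x. (?g x)\<^sup>2 \<partial>?P) ^ card {..<n} - 3 / 4"
    proof (rule integral_PiM_density_diff_le)
      show "0 \<le> ?g x" for x using \<delta> by (auto simp: sgn_if)
      show "prob_space ?P'" unfolding P'_eq by (rule prob_space_two_point)
      show "integrable ?P ?g" "integrable ?P (\<lambda>x. (?g x)\<^sup>2)"
        by (rule integrable_two_point; measurable)+
      show "(\<lambda>xs. measure (Q xs) A) \<in> borel_measurable (\<Pi>\<^sub>M j\<in>{..<n}. ?P)"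
        by (rule measurable_channel[OF Q A sets_PiM_samples]) simp
      fix xs assume "xs \<in> space (\<Pi>\<^sub>M j\<in>{..<n}. ?P)"
      then have "xs \<in> space (samples d n)" by (simp add: samples_def space_PiM)
      then show "0 \<le> measure (Q xs) A \<and> measure (Q xs) A \<le> 1"
        using channel_prob_space[OF Q] by (simp add: prob_space.prob_le_1)
    qed (use prob_space_two_point in auto)
    then show "(\<integral>xs. measure (Q xs) A \<partial>(\<Pi>\<^sub>M j\<in>{..<n}. ?P'))
        - (\<integral>xs. measure (Q xs) A \<partial>(\<Pi>\<^sub>M j\<in>{..<n}. ?P)) \<le> 1 / 2"
      using pow unfolding g2 by simp
  qed (use \<delta> \<open>0 < r\<close> in auto)
  also have "(\<delta> * r / 2)\<^sup>2 / 4 = r\<^sup>2 / (128 * real n)"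
    by (simp add: power_mult_distrib power_divide \<delta>2)
  finally show ?thesis .
qed

section \<open>The privacy term\<close>

text \<open>Group privacy by a hybrid argument: \<open>zs\<close> is turned into \<open>xs\<close>
  one observation at a time, and only positions where the two differ cost \<open>\<epsilon>\<close>.
  The sum is their Hamming distance.\<close>

lemma adjacent_hybrid_diff:
  fixes f :: "(nat \<Rightarrow> nat \<Rightarrow> real) \<Rightarrow> real"
  assumes f: "\<And>xs xs'. \<lbrakk>xs \<in> space (samples d n); xs' \<in> space (samples d n); adjacent n xs xs'\<rbrakk>
      \<Longrightarrow> \<bar>f xs - f xs'\<bar> \<le> \<epsilon>"
    and xs: "xs \<in> space (samples d n)" and zs: "zs \<in> space (samples d n)"
  shows "\<bar>f xs - f zs\<bar> \<le> \<epsilon> * (\<Sum>j<n. indicator {x. x \<noteq> zs j} (xs j))"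
proof -
  define y where "y m = (\<lambda>j. if j < m then xs j else zs j)" for m
  have y: "y m \<in> space (samples d n)" for m
    using xs zs by (auto simp: y_def samples_def space_PiM PiE_iff extensional_def)
  have hybrid: "m \<le> n \<Longrightarrow> \<bar>f (y m) - f zs\<bar> \<le> \<epsilon> * (\<Sum>j<m. indicator {x. x \<noteq> zs j} (xs j))" for m
  proof (induction m)
    case 0
    then show ?case by (simp add: y_def)
  next
    case (Suc m)
    have "\<bar>f (y (Suc m)) - f (y m)\<bar> \<le> \<epsilon> * indicator {x. x \<noteq> zs m} (xs m)"
    proof (cases "xs m = zs m")
      case True
      then have "y (Suc m) = y m" by (auto simp: y_def less_Suc_eq)
      then show ?thesis using True by simp
    next
      case False
      have "adjacent n (y (Suc m)) (y m)"
        unfolding adjacent_def using Suc.prems by (intro exI[of _ m]) (auto simp: y_def)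
      then show ?thesis using f[OF y y] False by simp
    qed
    then show ?case using Suc by (simp add: distrib_left)
  qed
  \<comment> \<open>From index \<open>n\<close> on both samples are \<open>undefined\<close>, so the
    last hybrid equals \<open>xs\<close> as a function.\<close>
  have "y n = xs"
    using xs zs by (auto simp: y_def samples_def space_PiM PiE_iff extensional_def)
  then show ?thesis using hybrid[of n] by simp
qed

text \<open>Inside the space, differing from the origin means that some coordinate below
  \<open>d\<close> is nonzero, a finite union of measurable conditions.\<close>

lemma measurable_indicator_nonzero [measurable]:
  "indicator {x. x \<noteq> axis_point d 0} \<in> borel_measurable (eucl d)"
proof -
  have "{x \<in> space (eucl d). x \<noteq> axis_point d 0} = {x \<in> space (eucl d). \<exists>i\<in>{..<d}. x i \<noteq> 0}"
    by (auto simp: axis_point_def eucl_def space_PiM PiE_iff extensional_def fun_eq_iff split: if_splits)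
  also have "\<dots> \<in> sets (eucl d)"
    by (intro sets.sets_Collect_finite_Ex) (auto intro!: borel_measurable_neq)
  finally show ?thesis
    by (simp add: borel_measurable_indicator_iff Int_def conj_commute)
qed

text \<open>The bound by Hamming distance is integrated against the sample law, with the all-zero
  sample as reference. By linearity the expected number of nonzero observations is at most
  \<open>real n * p\<close>. A fixed reference sample makes a coupling of two product laws
  unnecessary.\<close>

lemma private_expectation_near_constant:
  assumes Q: "Q \<in> tv_private_channels d n \<epsilon>" and A: "A \<in> sets (eucl d)"
    and "0 \<le> p" "p \<le> 1" "0 \<le> \<epsilon>"
  shows "\<bar>(\<integral>xs. measure (Q xs) A \<partial>(\<Pi>\<^sub>M j\<in>{..<n}. two_point d p a 0))
      - measure (Q (\<lambda>j\<in>{..<n}. axis_point d 0)) A\<bar> \<le> \<epsilon> * (real n * p)"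
proof -
  let ?P = "two_point d p a 0" and ?z = "\<lambda>j\<in>{..<n}. axis_point d 0"
  let ?M = "\<Pi>\<^sub>M j\<in>{..<n}. ?P" and ?I = "indicator {x. x \<noteq> axis_point d 0} :: _ \<Rightarrow> real"
  interpret M: prob_space ?M by (intro prob_space_PiM prob_space_two_point)
  have ch: "Q \<in> channels d n" using Q by (simp add: tv_private_channels_def)
  have sp: "space ?M = space (samples d n)" by (simp add: samples_def space_PiM)
  have z: "?z \<in> space (samples d n)" by (auto simp: samples_def space_PiM)
  have int: "integrable ?M (\<lambda>xs. measure (Q xs) A)"
    using channel_prob_space[OF ch] sp
    by (intro M.integrable_const_bound[of _ 1] measurable_channel[OF ch A] sets_PiM_samples)
      (auto simp: prob_space.prob_le_1)
  have comp: "integrable ?M (\<lambda>xs. ?I (xs j))" "(\<integral>xs. ?I (xs j) \<partial>?M) \<le> p" if "j < n" for j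
  proof -
    have [measurable]: "(\<lambda>xs. xs j) \<in> ?M \<rightarrow>\<^sub>M ?P"
      using that by (intro measurable_component_singleton) simp
    have "(\<lambda>xs. xs j) \<in> ?M \<rightarrow>\<^sub>M eucl d"
      by measurable (use that in simp)
    then have "(\<lambda>xs. ?I (xs j)) \<in> borel_measurable ?M"
      by (rule measurable_compose) (rule measurable_indicator_nonzero)
    then show "integrable ?M (\<lambda>xs. ?I (xs j))"
      by (intro M.integrable_const_bound[of _ 1] AE_I2) (simp_all split: split_indicator)
    have marginal: "distr ?M ?P (\<lambda>xs. xs j) = ?P"
      using that distr_PiM_component[of "{..<n}" "\<lambda>_. ?P" j] by (simp add: prob_space_two_point)
    have "(\<integral>x. ?I x \<partial>distr ?M ?P (\<lambda>xs. xs j)) = (\<integral>xs. ?I (xs j) \<partial>?M)"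
      by (rule integral_distr) (simp_all add: that measurable_cong_sets[OF sets_two_point refl])
    then have "(\<integral>xs. ?I (xs j) \<partial>?M) = (\<integral>x. ?I x \<partial>?P)"
      by (simp only: marginal)
    also have "\<dots> = ?I (axis_point d a) * p"
      using assms by (subst integral_two_point) auto
    \<comment> \<open>Equality can fail, since the atom at \<open>a\<close> may coincide with the
      origin.\<close>
    also have "\<dots> \<le> p"
      using \<open>0 \<le> p\<close> by (simp add: indicator_def)
    finally show "(\<integral>xs. ?I (xs j) \<partial>?M) \<le> p" .
  qed
  have "\<bar>(\<integral>xs. measure (Q xs) A \<partial>?M) - measure (Q ?z) A\<bar>
      = \<bar>\<integral>xs. measure (Q xs) A - measure (Q ?z) A \<partial>?M\<bar>"
    using int by (simp add: M.prob_space)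
  also have "\<dots> \<le> (\<integral>xs. \<bar>measure (Q xs) A - measure (Q ?z) A\<bar> \<partial>?M)"
    by (rule integral_abs_bound)
  also have "\<dots> \<le> (\<integral>xs. \<epsilon> * (\<Sum>j<n. ?I (xs j)) \<partial>?M)"
  proof (rule integral_mono)
    fix xs assume "xs \<in> space ?M"
    then have xs: "xs \<in> space (samples d n)" using sp by simp
    have "\<bar>measure (Q xs) A - measure (Q ?z) A\<bar> \<le> \<epsilon> * (\<Sum>j<n. indicator {x. x \<noteq> ?z j} (xs j))"
      using Q A by (intro adjacent_hybrid_diff[OF _ xs z]) (auto simp: tv_private_channels_def)
    then show "\<bar>measure (Q xs) A - measure (Q ?z) A\<bar> \<le> \<epsilon> * (\<Sum>j<n. ?I (xs j))"
      by simp
  qed (use int comp in \<open>auto intro!: Bochner_Integration.integrable_sum\<close>)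
  also have "\<dots> = \<epsilon> * (\<Sum>j<n. \<integral>xs. ?I (xs j) \<partial>?M)"
    using comp by (simp add: Bochner_Integration.integral_sum)
  also have "\<dots> \<le> \<epsilon> * (\<Sum>j<n. p)"
    using comp \<open>0 \<le> \<epsilon>\<close> by (intro mult_left_mono sum_mono) auto
  finally show ?thesis by simp
qed

text \<open>The atom \<open>?a\<close> solves \<open>?a powr k * p = r powr k\<close>, so the moment
  constraint is tight and the mean is \<open>r * p powr ((k - 1) / k)\<close>. The separation
  \<open>?s\<close> is half of it.\<close>

lemma sup_risk_ge_privacy:
  assumes Q: "Q \<in> tv_private_channels d n \<epsilon>" and "0 < d" "0 < r" "0 < k"
    and p: "0 < p" "p \<le> 1" "\<epsilon> * (real n * p) \<le> 1 / 2" and "0 \<le> \<epsilon>"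
  shows "ennreal (r\<^sup>2 * (p\<^sup>2) powr ((k - 1) / k) / 16) \<le> (SUP P\<in>moment_class d k r. risk d n Q P)"
proof -
  let ?a = "r * p powr (- 1 / k)" and ?s = "r * p powr ((k - 1) / k) / 2"
  have ch: "Q \<in> channels d n" using Q by (simp add: tv_private_channels_def)
  have "?a powr k * p = r powr k"
    using assms by (simp add: powr_mult powr_powr powr_minus powr_divide field_simps)
  then have mom: "\<bar>?a\<bar> powr k * p \<le> r powr k" using \<open>0 < r\<close> by simp
  have "?a * p = r * (p powr (- 1 / k) * p powr 1)" using p by simp
  also have "p powr (- 1 / k) * p powr 1 = p powr ((k - 1) / k)"
    using \<open>0 < k\<close> by (subst powr_add[symmetric]) (simp add: field_simps)
  finally have ap: "?a * p = 2 * ?s" by simp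
  have "ennreal (?s\<^sup>2 / 4) \<le> (SUP P\<in>moment_class d k r. risk d n Q P)"
  proof (rule le_cam_two_point[OF ch \<open>0 < d\<close>, of _ "two_point d 0 ?a 0" _ _ "two_point d p ?a 0"])
    show "two_point d 0 ?a 0 \<in> moment_class d k r" "two_point d p ?a 0 \<in> moment_class d k r"
      using mom p \<open>0 < d\<close> by (auto intro!: two_point_in_moment_class)
    show "mean d (two_point d 0 ?a 0) 0 = 0" "mean d (two_point d p ?a 0) 0 = 2 * ?s"
      using p \<open>0 < d\<close> ap by (auto simp: mean_two_point)
    fix A assume A: "A \<in> sets (eucl d)"
    \<comment> \<open>Both expectations are compared with the value at the all-zero sample. For the
      point mass, which is the case of weight 0, the distance is 0; for the other law it is at most
      \<epsilon> n p \<le> 1/2.\<close>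
    show "(\<integral>xs. measure (Q xs) A \<partial>(\<Pi>\<^sub>M j\<in>{..<n}. two_point d p ?a 0))
        - (\<integral>xs. measure (Q xs) A \<partial>(\<Pi>\<^sub>M j\<in>{..<n}. two_point d 0 ?a 0)) \<le> 1 / 2"
      using private_expectation_near_constant[OF Q A, of p ?a]
        private_expectation_near_constant[OF Q A, of 0 ?a] p \<open>0 \<le> \<epsilon>\<close> by simp
  qed (use \<open>0 < r\<close> in auto)
  also have "?s\<^sup>2 / 4 = r\<^sup>2 * (p\<^sup>2) powr ((k - 1) / k) / 16"
    by (simp add: power2_eq_square powr_mult)
  finally show ?thesis .
qed

section \<open>Choice of the constant and combination of the two bounds\<close>

theorem proposition2:
  fixes k \<epsilon>\<^sub>0 :: real
  assumes "k > 1" and "\<epsilon>\<^sub>0 > 0"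
  shows "\<exists>c>0. \<forall>d\<ge>1. \<forall>r>0. \<forall>n\<ge>1. \<forall>\<epsilon>\<ge>\<epsilon>\<^sub>0 / real n.
    minimax_risk d k r \<epsilon> n
      \<ge> ennreal (c * (r\<^sup>2 / real n + r\<^sup>2 * (1 / (\<epsilon>\<^sup>2 * (real n)\<^sup>2)) powr ((k - 1) / k)))"
proof -
  \<comment> \<open>\<open>K\<close> ensures \<open>1 / (\<epsilon> * real n) \<le> K * p\<close>
    for the \<open>p\<close> below: 2 serves when the minimum defining \<open>p\<close> is its
    second entry, and \<open>1 / \<epsilon>\<^sub>0\<close> when \<open>p = 1\<close>.\<close>
  define K where "K = max 2 (1 / \<epsilon>\<^sub>0)"
  define \<beta> where "\<beta> = (k - 1) / k"
  have \<beta>: "0 < \<beta>" using assms by (simp add: \<beta>_def)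
  have K: "2 \<le> K" "1 / \<epsilon>\<^sub>0 \<le> K" by (auto simp: K_def)
  \<comment> \<open>The factor lost in the rate when \<open>1 / (\<epsilon> * real n)\<close> is
    replaced by \<open>p\<close>.\<close>
  define D where "D = (K\<^sup>2) powr \<beta>"
  have D: "0 < D" using K by (simp add: D_def)
  \<comment> \<open>1/128 and 1/16 come from the two lower bounds; the final halving pays for
    passing from a maximum to a sum.\<close>
  define c where "c = min (1 / 128) (1 / (16 * D)) / 2"
  have c: "0 < c" "2 * c \<le> 1 / 128" "2 * c \<le> 1 / (16 * D)"
    using D by (auto simp: c_def)
  show ?thesis
  proof (intro exI[of _ c] conjI allI impI \<open>0 < c\<close>)
    fix d n :: nat and r \<epsilon> :: real
    assume "1 \<le> d" "0 < r" "1 \<le> n" and \<epsilon>: "\<epsilon>\<^sub>0 / real n \<le> \<epsilon>"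
    then have "0 < d" "0 < real n" by auto
    have \<epsilon>0: "0 < \<epsilon>" using \<epsilon> \<open>0 < real n\<close> \<open>\<epsilon>\<^sub>0 > 0\<close> by (meson divide_pos_pos less_le_trans)
    have \<epsilon>n: "\<epsilon>\<^sub>0 \<le> \<epsilon> * real n" using \<epsilon> \<open>0 < real n\<close> by (simp add: field_simps)
    \<comment> \<open>The largest probability with
      \<open>\<epsilon> * (real n * p) \<le> 1 / 2\<close>.\<close>
    define p where "p = min 1 (1 / (2 * (\<epsilon> * real n)))"
    have p: "0 < p" "p \<le> 1" using \<epsilon>0 \<open>0 < real n\<close> by (auto simp: p_def)
    have "p \<le> 1 / (2 * (\<epsilon> * real n))" by (simp add: p_def)
    then have p2: "\<epsilon> * (real n * p) \<le> 1 / 2"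
      using \<epsilon>0 \<open>0 < real n\<close> by (simp add: field_simps)
    have pK: "1 / (\<epsilon> * real n) \<le> K * p"
    proof (cases "p = 1")
      case True
      have "1 / (\<epsilon> * real n) \<le> 1 / \<epsilon>\<^sub>0"
        using \<epsilon>n \<open>\<epsilon>\<^sub>0 > 0\<close> by (intro divide_left_mono) auto
      then show ?thesis using K True by simp
    next
      case False
      then have "1 / (\<epsilon> * real n) = 2 * p" by (auto simp: p_def min_def split: if_splits)
      then show ?thesis using K p by simp
    qed
    let ?T1 = "r\<^sup>2 / real n" and ?T2 = "r\<^sup>2 * (1 / (\<epsilon>\<^sup>2 * (real n)\<^sup>2)) powr \<beta>"
    have "1 / (\<epsilon>\<^sup>2 * (real n)\<^sup>2) = (1 / (\<epsilon> * real n))\<^sup>2"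
      by (simp add: power_mult_distrib power_divide)
    also have "\<dots> \<le> (K * p)\<^sup>2"
      using pK \<epsilon>0 by (intro power_mono) auto
    \<comment> \<open>The assumption \<open>k > 1\<close> makes the exponent \<beta> positive, so
      the power is monotone in its base.\<close>
    finally have "(1 / (\<epsilon>\<^sup>2 * (real n)\<^sup>2)) powr \<beta> \<le> (K\<^sup>2 * p\<^sup>2) powr \<beta>"
      using \<beta> by (intro powr_mono2) (auto simp: power_mult_distrib)
    then have T2: "?T2 \<le> r\<^sup>2 * (D * (p\<^sup>2) powr \<beta>)"
      by (intro mult_left_mono) (auto simp: powr_mult D_def)
    have b1: "2 * c * ?T1 \<le> r\<^sup>2 / (128 * real n)"
      using mult_right_mono[OF c(2), of ?T1] by simp
    have "2 * c * ?T2 \<le> 1 / (16 * D) * ?T2"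
      using c by (intro mult_right_mono) auto
    also have "\<dots> \<le> 1 / (16 * D) * (r\<^sup>2 * (D * (p\<^sup>2) powr \<beta>))"
      using D by (intro mult_left_mono[OF T2]) simp
    also have "\<dots> = r\<^sup>2 * (p\<^sup>2) powr \<beta> / 16" using D by simp
    finally have b2: "2 * c * ?T2 \<le> r\<^sup>2 * (p\<^sup>2) powr \<beta> / 16" .
    show "ennreal (c * (r\<^sup>2 / real n + r\<^sup>2 * (1 / (\<epsilon>\<^sup>2 * (real n)\<^sup>2)) powr ((k - 1) / k)))
        \<le> minimax_risk d k r \<epsilon> n"
      unfolding minimax_risk_def \<beta>_def[symmetric]
    proof (rule INF_greatest)
      fix Q assume Q: "Q \<in> tv_private_channels d n \<epsilon>"
      then have ch: "Q \<in> channels d n" by (simp add: tv_private_channels_def)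
      let ?R = "SUP P\<in>moment_class d k r. risk d n Q P"
      have R1: "ennreal (r\<^sup>2 / (128 * real n)) \<le> ?R"
        by (rule sup_risk_ge_sampling[OF ch \<open>0 < d\<close> \<open>0 < r\<close> \<open>1 \<le> n\<close>])
      have R2: "ennreal (r\<^sup>2 * (p\<^sup>2) powr \<beta> / 16) \<le> ?R"
        unfolding \<beta>_def using assms \<epsilon>0
        by (intro sup_risk_ge_privacy[OF Q \<open>0 < d\<close> \<open>0 < r\<close> _ p p2]) auto
      \<comment> \<open>The left-hand side is the average of \<open>2 * c * ?T1\<close> and
        \<open>2 * c * ?T2\<close>, hence at most the larger of their bounds.\<close>
      have "c * (?T1 + ?T2) \<le> max (r\<^sup>2 / (128 * real n)) (r\<^sup>2 * (p\<^sup>2) powr \<beta> / 16)"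
        using b1 b2 by (simp add: algebra_simps max_def)
      then have "ennreal (c * (?T1 + ?T2))
          \<le> ennreal (max (r\<^sup>2 / (128 * real n)) (r\<^sup>2 * (p\<^sup>2) powr \<beta> / 16))"
        by (rule ennreal_leI)
      also have "\<dots> \<le> ?R"
        using R1 R2 by (simp add: max_def)
      finally show "ennreal (c * (?T1 + ?T2)) \<le> ?R" .
    qed
  qed
qed

end
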